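(* For every natural number $k\ge 1$ there exist constants $C>0$ and $N$, depending only on $k$, such that the following holds for every $n>N$ and every natural number $t\geq 1$. Let $E\subset\mathbb{R}^2$ be a set of $n$ points with no more than $t$ points of $E$ on any line, and let $(\alpha_1,\dots,\alpha_k)$ be a $k$-tuple of nonzero real numbers. Then the number of $k$-chains of type $(\alpha_1,\dots,\alpha_k)$ in $E$ is at most $$C\cdot\begin{cases} (\log_2 n)^{\frac{2k-6}{3}}\, t^{\frac{k-3}{3}}\, n^{\frac{4k+12}{9}} & \text{if } k\equiv 0 \pmod 3,\\ (\log_2 n)^{\frac{2k-2}{3}}\, t^{\frac{k-1}{3}}\, n^{\frac{4k+8}{9}} & \text{if } k\equiv 1 \pmod 3,\\ (\log_2 n)^{\frac{2k+2}{3}}\, t^{\frac{k+1}{3}}\, n^{\frac{4k+4}{9}} & \text{if } k\equiv 2 \pmod 3. \end{cases}$$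
   Context: For a $k$-tuple $(\alpha_1,\dots,\alpha_k)$ of real numbers, a $k$-chain of type $(\alpha_1,\dots,\alpha_k)$ in a finite set $E$ is a $(k+1)$-tuple $(R_1,\dots,R_{k+1})\in E^{k+1}$ such that $R_j\cdot R_{j+1}=\alpha_j$ for all $j=1,\dots,k$, where $\cdot$ is the standard dot product. Repetitions among the $R_j$ are not excluded. *)

theory Defs
  imports "HOL-Analysis.Analysis"
begin

text \<open>The tuples $(\alpha_1,\dots,\alpha_k)$ and $(R_1,\dots,R_{k+1})$ are lists, indexed from 0.\<close>

definition dot_chains :: "real list \<Rightarrow> (real ^ 2) set \<Rightarrow> (real ^ 2) list set" where
  "dot_chains \<alpha> E =
     {R. length R = length \<alpha> + 1 \<and> set R \<subseteq> E \<and>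
         (\<forall>j < length \<alpha>. (R ! j) \<bullet> (R ! (j + 1)) = \<alpha> ! j)}"

definition is_line :: "(real ^ 2) set \<Rightarrow> bool" where
  "is_line L \<longleftrightarrow> affine L \<and> aff_dim L = 1"

text \<open>Since 0 powr 0 = 0, the value at n = 1 (where log 2 n = 0) is 0 also for zero exponents;
  the bound is meant for n > 1.\<close>

definition chain_bound :: "nat \<Rightarrow> nat \<Rightarrow> nat \<Rightarrow> real" where
  "chain_bound k t n =
     (if k mod 3 = 0 then
        log 2 (real n) powr ((2 * real k - 6) / 3) * real t powr ((real k - 3) / 3)
          * real n powr ((4 * real k + 12) / 9)
      else if k mod 3 = 1 then
        log 2 (real n) powr ((2 * real k - 2) / 3) * real t powr ((real k - 1) / 3)
          * real n powr ((4 * real k + 8) / 9)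
      else
        log 2 (real n) powr ((2 * real k + 2) / 3) * real t powr ((real k + 1) / 3)
          * real n powr ((4 * real k + 4) / 9))"

end

theory Submission
  imports Defs
begin

text \<open>
  Everything rests on one estimate: a set \<open>E\<close> of \<open>n\<close> points in the plane contains at most
  \<open>9 n\<^sup>4\<^sup>/\<^sup>3\<close> ordered pairs with a prescribed nonzero dot product \<open>\<alpha>\<close>. Indeed \<open>p \<bullet> q = \<alpha>\<close> says that
  \<open>p\<close> lies on a line that determines \<open>q\<close>, so such pairs are incidences between \<open>n\<close> points and at
  most \<open>n\<close> lines, and the Szemeredi-Trotter theorem (\<open>Szemeredi_Trotter\<close>) bounds them.

  Given this, write \<open>k = b + 2m + 1\<close> with \<open>m = \<lfloor>k/3\<rfloor>\<close>. The last \<open>2m + 2\<close> points of a \<open>k\<close>-chain split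
  into \<open>m + 1\<close> consecutive pairs, each with a prescribed dot product; forgetting the
  conditions between different pairs leaves at most \<open>(9 n\<^sup>4\<^sup>/\<^sup>3)\<^sup>m\<^sup>+\<^sup>1\<close> choices. The first \<open>b\<close> points are then
  chosen backwards one at a time, each on a line determined by its successor, so in at most \<open>t\<close>
  ways. The product \<open>t\<^sup>b (9 n\<^sup>4\<^sup>/\<^sup>3)\<^sup>m\<^sup>+\<^sup>1\<close> has the exponents of \<open>t\<close> and \<open>n\<close> in the claim for each
  residue of \<open>k\<close> modulo 3, and the logarithmic factor is at least 1 for \<open>n \<ge> 2\<close>.

  The Szemeredi-Trotter theorem is proved by Szekely's method. Joining consecutive points on every
  line gives a straight-line graph with nearly as many edges as there are incidences, whose
  crossings are bounded by the number of pairs of lines; the crossing lemma (\<open>crossing_lemma\<close>) forces a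
  graph with many edges to have many crossings. The crossing lemma follows by random sampling of vertices from
  the linear bound \<open>|G| \<le> 3 |V|\<close> for crossing-free straight-line graphs
  (\<open>card_edges_le\<close>). That bound is obtained without faces or Euler's formula, by sweeping each
  wedge between neighbouring edges until it meets a vertex and charging the edge to that vertex.
\<close>

section \<open>Straight-line graphs in the plane\<close>

type_synonym point = "real \<times> real"
type_synonym edge = "point \<times> point"

text \<open>
  An edge is a pair of points, the left one first; all vertices of a graph have different
  abscissas, so an edge is the graph of an affine function on an interval.
\<close>

definition slope :: "edge \<Rightarrow> real" where
  "slope e = (snd (snd e) - snd (fst e)) / (fst (snd e) - fst (fst e))"

definition height :: "edge \<Rightarrow> real \<Rightarrow> real" where
  "height e x = snd (fst e) + slope e * (x - fst (fst e))"

definition spans :: "edge \<Rightarrow> real \<Rightarrow> bool" where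
  "spans e x \<longleftrightarrow> fst (fst e) < x \<and> x < fst (snd e)"

text \<open>
  Two edges that overlap in a segment also cross in this sense, while edges that only share an
  endpoint do not.
\<close>

definition crosses :: "edge \<Rightarrow> edge \<Rightarrow> bool" where
  "crosses e f \<longleftrightarrow> e \<noteq> f \<and> (\<exists>x. spans e x \<and> spans f x \<and> height e x = height f x)"

lemma height_left: "height e (fst (fst e)) = snd (fst e)"
  by (simp add: height_def)

lemma height_right: "fst (fst e) \<noteq> fst (snd e) \<Longrightarrow> height e (fst (snd e)) = snd (snd e)"
  by (simp add: height_def slope_def)

lemma height_shift: "height e y = height e x + slope e * (y - x)"
  by (simp add: height_def algebra_simps)

lemma height_less_iff_slope_less:
  assumes "fst e = fst f" "fst (fst e) < x"
  shows "height e x < height f x \<longleftrightarrow> slope e < slope f"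
  using assms by (simp add: height_def)

text \<open>
  The difference of the two heights is affine, so its zero can be written down explicitly; it lies
  strictly between \<open>x\<close> and \<open>y\<close>. Hence \<open>y\<close> may be an endpoint of either edge.
\<close>

lemma crosses_if_order_changes:
  assumes "height e x < height f x" "height f y < height e y"
    and "spans e x" "spans f x"
    and "y \<in> {fst (fst e)..fst (snd e)}" "y \<in> {fst (fst f)..fst (snd f)}"
  shows "crosses e f"
proof -
  define d where "d z = height f z - height e z" for z
  define r where "r = d x / (d x - d y)"
  define z where "z = x + (y - x) * r"
  have d: "d x > 0" "d y < 0" using assms by (auto simp: d_def)
  then have r: "0 < r" "r < 1" "(d x - d y) * r = d x" by (auto simp: r_def field_simps)
  have dz: "d u = d x + (slope f - slope e) * (u - x)" for u
    unfolding d_def by (simp add: height_shift[of _ u x] algebra_simps)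
  have "d z = d x + ((slope f - slope e) * (y - x)) * r"
    by (subst dz) (simp add: z_def)
  also have "(slope f - slope e) * (y - x) = d y - d x" using dz[of y] by simp
  also have "d x + (d y - d x) * r = d x - (d x - d y) * r" by (simp add: algebra_simps)
  also have "\<dots> = 0" using r by simp
  finally have 0: "height e z = height f z" by (simp add: d_def)
  have between: "(x < z \<and> z < y) \<or> (y < z \<and> z < x) \<or> (x = y)"
  proof -
    have "x < y \<Longrightarrow> 0 < (y - x) * r \<and> (y - x) * r < (y - x) * 1"
      using r by (intro conjI mult_strict_left_mono mult_pos_pos) auto
    moreover have "y < x \<Longrightarrow> 0 < (x - y) * r \<and> (x - y) * r < (x - y) * 1"
      using r by (intro conjI mult_strict_left_mono mult_pos_pos) auto
    moreover have "z = x - (x - y) * r" by (simp add: z_def algebra_simps)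
    moreover have "z = x + (y - x) * r" by (simp add: z_def)
    ultimately show ?thesis by (smt (verit))
  qed
  then have "spans e z \<and> spans f z" using assms d unfolding spans_def by auto
  then show ?thesis using 0 assms unfolding crosses_def by auto
qed

text \<open>
  A generic shear makes the abscissas of finitely many points distinct, so \<open>inj_fst\<close> costs no
  generality; it turns the order of the vertices from left to right into a strict one.
\<close>

locale straight_line_graph =
  fixes V :: "point set" and G :: "edge set"
  assumes finite_V: "finite V"
    and inj_fst: "inj_on fst V"
    and edge: "e \<in> G \<Longrightarrow> fst e \<in> V \<and> snd e \<in> V \<and> fst (fst e) < fst (snd e)"
    and avoids: "\<lbrakk>e \<in> G; v \<in> V; spans e (fst v)\<rbrakk> \<Longrightarrow> height e (fst v) \<noteq> snd v"
begin

lemma finite_G: "finite G"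
  by (rule finite_subset[of _ "V \<times> V"]) (use edge finite_V in \<open>auto simp: mem_Times_iff\<close>)

text \<open>
  If two edges leaving a vertex in the same direction had different lengths, the longer one would
  pass through the endpoint of the shorter one.
\<close>

lemma eq_if_same_slope_at_left:
  assumes "e \<in> G" "f \<in> G" "fst e = fst f" "slope e = slope f"
  shows "e = f"
proof -
  have *: False if "g \<in> G" "h \<in> G" "fst g = fst h" "slope g = slope h" "fst (snd g) < fst (snd h)" for g h
  proof -
    have "height h (fst (snd g)) = snd (snd g)"
      using that edge[of g] height_right[of g] by (simp add: height_def)
    moreover have "spans h (fst (snd g))" using that edge[of g] by (simp add: spans_def)
    ultimately show False using avoids that edge[of g] by blast
  qed
  have "fst (snd e) = fst (snd f)"
    using *[of e f] *[of f e] assms by (metis linorder_neq_iff)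
  then have "snd e = snd f" using inj_fst edge assms by (metis inj_onD)
  then show ?thesis using assms by (simp add: prod_eq_iff)
qed

lemma eq_if_same_slope_at_right:
  assumes "e \<in> G" "f \<in> G" "snd e = snd f" "slope e = slope f"
  shows "e = f"
proof -
  have same: "height e x = height f x" for x
    using assms edge[of e] edge[of f] height_right[of e] height_right[of f]
      height_shift[of e x "fst (snd e)"] height_shift[of f x "fst (snd e)"] by auto
  have *: False if "g \<in> G" "h \<in> G" "snd g = snd h" "\<And>x. height g x = height h x" "fst (fst h) < fst (fst g)" for g h
  proof -
    have "height h (fst (fst g)) = snd (fst g)"
      using that height_left[of g] by metis
    moreover have "spans h (fst (fst g))" using that edge[of g] by (simp add: spans_def)
    ultimately show False using avoids that edge[of g] by blast
  qed
  have "fst (fst e) = fst (fst f)"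
    using *[of e f] *[of f e] assms same by (metis linorder_neq_iff)
  then have "fst e = fst f" using inj_fst edge assms by (metis inj_onD)
  then show ?thesis using assms by (simp add: prod_eq_iff)
qed

text \<open>
  Two distinct edges with a shared endpoint and a crossing point would leave that endpoint in the
  same direction, and the longer one would pass through an endpoint of the shorter one. That a
  crossing involves four different vertices is what makes crossings so much rarer than edges
  in a random sample of the vertices.
\<close>

lemma crosses_imp_no_common_vertex:
  assumes "e \<in> G" "f \<in> G" "crosses e f"
  shows "distinct [fst e, snd e, fst f, snd f]"
proof -
  obtain x where x: "spans e x" "spans f x" "height e x = height f x" and ne: "e \<noteq> f"
    using assms unfolding crosses_def by blast
  have "fst e \<noteq> fst f"
  proof
    assume l: "fst e = fst f"
    then have "slope e = slope f"
      using x height_less_iff_slope_less[of e f x] height_less_iff_slope_less[of f e x]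
      by (auto simp: spans_def)
    then show False using eq_if_same_slope_at_left assms l ne by blast
  qed
  moreover have "snd e \<noteq> snd f"
  proof
    assume r: "snd e = snd f"
    then have "height e (fst (snd e)) = height f (fst (snd e))"
      using height_right[of e] height_right[of f] edge assms by (metis less_irrefl)
    then have "slope e * (fst (snd e) - x) = slope f * (fst (snd e) - x)"
      using x height_shift[of e "fst (snd e)" x] height_shift[of f "fst (snd e)" x] by simp
    then have "slope e = slope f" using x by (auto simp: spans_def)
    then show False using eq_if_same_slope_at_right assms r ne by blast
  qed
  ultimately show ?thesis using x edge[of e] edge[of f] assms by (auto simp: spans_def)
qed

section \<open>Crossing-free straight-line graphs have linearly many edges\<close>

definition top_edges :: "edge set" where
  "top_edges = {e \<in> G. \<forall>f\<in>G. fst f = fst e \<longrightarrow> slope f \<le> slope e}"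

text \<open>
  The edge \<open>e'\<close> follows \<open>e\<close> immediately in counterclockwise order among the edges leaving their
  left endpoint to the right, and \<open>w\<close> is the first vertex that a vertical segment, swept from that
  endpoint to the right between \<open>e\<close> and \<open>e'\<close>, runs into. The tip \<open>w\<close> may lie on the boundary of the
  wedge, as the right endpoint of the shorter edge.
\<close>

definition wedge :: "edge \<Rightarrow> edge \<Rightarrow> point \<Rightarrow> bool" where
  "wedge e e' w \<longleftrightarrow> e' \<in> G \<and> fst e' = fst e \<and> slope e < slope e'
     \<and> (\<forall>f\<in>G. fst f = fst e \<longrightarrow> slope e < slope f \<longrightarrow> slope e' \<le> slope f)
     \<and> w \<in> V \<and> fst (fst e) < fst w \<and> fst w \<le> fst (snd e) \<and> fst w \<le> fst (snd e')
     \<and> height e (fst w) \<le> snd w \<and> snd w \<le> height e' (fst w)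
     \<and> (\<forall>v\<in>V. fst (fst e) < fst v \<longrightarrow> fst v < fst w \<longrightarrow>
          \<not> (height e (fst v) \<le> snd v \<and> snd v \<le> height e' (fst v)))"

text \<open>
  The sweep stops at the latest at the right endpoint of the shorter of the two edges.
\<close>

lemma wedge_exists:
  assumes "e \<in> G - top_edges"
  shows "\<exists>e' w. wedge e e' w"
proof -
  define F where "F = {f \<in> G. fst f = fst e \<and> slope e < slope f}"
  have "finite F" using finite_G by (simp add: F_def)
  obtain f where "f \<in> G" "fst f = fst e" "\<not> slope f \<le> slope e"
    using assms unfolding top_edges_def by blast
  then have "f \<in> F" by (simp add: F_def)
  then have "F \<noteq> {}" by blast
  define e' where "e' = arg_min_on slope F"
  have e'F: "e' \<in> F" unfolding e'_def by (intro arg_min_if_finite(1)) fact+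
  then have e': "e' \<in> G" "fst e' = fst e" "slope e < slope e'" by (auto simp: F_def)
  have least: "slope e' \<le> slope f" if "f \<in> F" for f
    unfolding e'_def by (intro arg_min_least) fact+
  define W where "W = {v \<in> V. fst (fst e) < fst v \<and> fst v \<le> fst (snd e) \<and> fst v \<le> fst (snd e')
     \<and> height e (fst v) \<le> snd v \<and> snd v \<le> height e' (fst v)}"
  have fin: "finite W" using finite_V by (simp add: W_def)
  have ed: "e \<in> G" "snd e \<in> V" "snd e' \<in> V" "fst (fst e) < fst (snd e)" "fst (fst e) < fst (snd e')"
    using edge[of e] edge[of e'] e' assms by auto
  have hr: "height e (fst (snd e)) = snd (snd e)" "height e' (fst (snd e')) = snd (snd e')"
    using ed e' height_right by auto
  have lt: "height e x < height e' x" if "fst (fst e) < x" for x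
    using height_less_iff_slope_less[of e e' x] that e' by simp
  have "W \<noteq> {}"
  proof (cases "fst (snd e) \<le> fst (snd e')")
    case True
    then have "snd e \<in> W" using ed hr lt[of "fst (snd e)"] by (simp add: W_def)
    then show ?thesis by blast
  next
    case False
    then have "snd e' \<in> W" using ed hr lt[of "fst (snd e')"] by (simp add: W_def)
    then show ?thesis by blast
  qed
  define w where "w = arg_min_on fst W"
  have w: "w \<in> W" unfolding w_def by (intro arg_min_if_finite(1)) fact+
  have wl: "fst w \<le> fst v" if "v \<in> W" for v
    unfolding w_def by (intro arg_min_least) fact+
  have "wedge e e' w"
    unfolding wedge_def
  proof (intro conjI ballI impI)
    fix v assume v: "v \<in> V" "fst (fst e) < fst v" "fst v < fst w"
    then have "v \<notin> W" using wl[of v] by auto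
    then show "\<not> (height e (fst v) \<le> snd v \<and> snd v \<le> height e' (fst v))"
      using v w by (auto simp: W_def)
  qed (use e' least w in \<open>auto simp: F_def W_def\<close>)
  then show ?thesis by blast
qed

end

locale plane_straight_line_graph = straight_line_graph +
  assumes no_crossing: "\<lbrakk>e \<in> G; f \<in> G\<rbrakk> \<Longrightarrow> \<not> crosses e f"
begin

lemma order_persists:
  assumes "e \<in> G" "f \<in> G" "spans e x" "spans f x" "height e x \<le> height f x"
    and "y \<in> {fst (fst e)..fst (snd e)}" "y \<in> {fst (fst f)..fst (snd f)}"
  shows "height e y \<le> height f y"
proof (cases "e = f")
  case False
  then have "height e x \<noteq> height f x"
    using no_crossing[of e f] assms by (auto simp: crosses_def)
  then show ?thesis
    using crosses_if_order_changes[of e x f y] no_crossing[of e f] assms by force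
qed simp

text \<open>
  An edge \<open>f\<close> between \<open>e\<close> and \<open>e'\<close> cannot leave the wedge when it is followed to the left, because
  nothing crosses. So it would have to start inside the wedge, before the first vertex there, or
  pass through the apex, or start at the apex between two neighbouring edges; all three are
  impossible.
\<close>

lemma wedge_is_empty:
  assumes e: "e \<in> G" and w: "wedge e e' w" and f: "f \<in> G"
    and x: "spans e x" "spans e' x" "spans f x" "x \<le> fst w"
  shows "\<not> (height e x < height f x \<and> height f x < height e' x)"
proof
  assume h: "height e x < height f x \<and> height f x < height e' x"
  have e': "e' \<in> G" "fst e' = fst e" "slope e < slope e'" 
    and least: "\<And>g. g \<in> G \<Longrightarrow> fst g = fst e \<Longrightarrow> slope e < slope g \<Longrightarrow> slope e' \<le> slope g"
    and first: "\<And>v. v \<in> V \<Longrightarrow> fst (fst e) < fst v \<Longrightarrow> fst v < fst w \<Longrightarrow>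
          \<not> (height e (fst v) \<le> snd v \<and> snd v \<le> height e' (fst v))"
    using w unfolding wedge_def by auto
  define a where "a = max (fst (fst e)) (fst (fst f))"
  have a: "a < x" "a \<in> {fst (fst e)..fst (snd e)}" "a \<in> {fst (fst e')..fst (snd e')}"
     "a \<in> {fst (fst f)..fst (snd f)}" using x e' by (auto simp: a_def spans_def)
  have ha: "height e a \<le> height f a" "height f a \<le> height e' a"
    using order_persists[of e f x a] order_persists[of f e' x a] e e' f x h a by auto
  consider "fst (fst e) < fst (fst f)" | "fst (fst f) < fst (fst e)" | "fst (fst f) = fst (fst e)"
    by linarith
  then show False
  proof cases
    case 1
    then have "height e (fst (fst f)) \<le> snd (fst f)" "snd (fst f) \<le> height e' (fst (fst f))"
      using ha height_left[of f] by (auto simp: a_def max_def)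
    moreover have "fst (fst f) < fst w" using a x 1 by (auto simp: a_def)
    ultimately show False using first[of "fst f"] edge[OF f] 1 by blast
  next
    case 2
    then have "height f (fst (fst e)) = snd (fst e)"
      using ha height_left[of e] height_left[of e'] e' by (auto simp: a_def max_def)
    moreover have "spans f (fst (fst e))" using 2 x by (auto simp: spans_def)
    ultimately show False using avoids[OF f] edge[OF e] by blast
  next
    case 3
    then have "fst f = fst e" using inj_fst edge e f by (metis inj_onD)
    then have "slope e < slope f" "slope f < slope e'"
      using h height_less_iff_slope_less[of e f x] height_less_iff_slope_less[of f e' x] e' x
      by (auto simp: spans_def)
    then show False using least[OF f] \<open>fst f = fst e\<close> by auto
  qed
qed

text \<open>
  Just to the left of \<open>w\<close>, two wedges with tip \<open>w\<close> lie one above the other, since neither contains an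
  edge in its interior. This order persists up to \<open>w\<close>, so \<open>w\<close> lies on the upper edge of the lower
  wedge, and strictly below the upper edge of the upper wedge because a wedge has positive width
  to the right of its apex.
\<close>

lemma wedges_with_same_tip:
  assumes e: "e \<in> G" "wedge e e' w" and f: "f \<in> G" "wedge f f' w" and "e \<noteq> f"
  shows "(snd w = height e' (fst w) \<and> snd w < height f' (fst w)) \<or>
         (snd w = height f' (fst w) \<and> snd w < height e' (fst w))"
proof -
  \<comment> \<open>At the abscissa \<open>x\<close> all four edges are present.\<close>
  define x where "x = (max (fst (fst e)) (fst (fst f)) + fst w) / 2"
  have e': "e' \<in> G" "fst e' = fst e" "slope e < slope e'" 
    and f': "f' \<in> G" "fst f' = fst f" "slope f < slope f'" 
    and we: "fst (fst e) < fst w" "fst w \<le> fst (snd e)" "fst w \<le> fst (snd e')"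
    and wf: "fst (fst f) < fst w" "fst w \<le> fst (snd f)" "fst w \<le> fst (snd f')"
    and he: "height e (fst w) \<le> snd w" "snd w \<le> height e' (fst w)"
    and hf: "height f (fst w) \<le> snd w" "snd w \<le> height f' (fst w)"
    using e f unfolding wedge_def by auto
  have xl: "fst (fst e) < x" "fst (fst f) < x" "x < fst w" using we wf by (auto simp: x_def)
  have sp: "spans e x" "spans f x" "spans e' x" "spans f' x"
    using xl we wf e' f' by (auto simp: spans_def)
  have lt: "height e x < height e' x" "height f x < height f' x"
    "height e (fst w) < height e' (fst w)" "height f (fst w) < height f' (fst w)"
    using height_less_iff_slope_less[of e e'] height_less_iff_slope_less[of f f'] xl we wf e' f' by auto
  have ne: "height e x \<noteq> height f x"
    using no_crossing[OF e(1) f(1)] \<open>e \<noteq> f\<close> sp by (auto simp: crosses_def)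
  show ?thesis
  proof (cases "height e x < height f x")
    case True
    then have "height e' x \<le> height f x"
      using wedge_is_empty[OF e f(1), of x] sp xl by force
    then have "height e' (fst w) \<le> height f (fst w)"
      by (rule order_persists[rotated 4]) (use sp e' f we wf in auto)
    then show ?thesis using he hf lt by linarith
  next
    case False
    then have "height f' x \<le> height e x"
      using wedge_is_empty[OF f e(1), of x] sp xl ne by force
    then have "height f' (fst w) \<le> height e (fst w)"
      by (rule order_persists[rotated 4]) (use sp f' e we wf in auto)
    then show ?thesis using he hf lt by linarith
  qed
qed

text \<open>
  The topmost edge at each left endpoint accounts for at most \<open>card V\<close> edges. All others are
  charged to the tip of their wedge, and each vertex is charged at most twice: once by a wedge whose upper edge
  passes through it, once by a wedge whose upper edge passes above it.
\<close>

lemma card_edges_le: "card G \<le> 3 * card V"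
proof -
  have "\<forall>e\<in>G - top_edges. \<exists>z. wedge e (fst z) (snd z)"
    using wedge_exists by fastforce
  then obtain z where z: "\<And>e. e \<in> G - top_edges \<Longrightarrow> wedge e (fst (z e)) (snd (z e))"
    by metis
  define tip where "tip e = snd (z e)" for e
  define nxt where "nxt e = fst (z e)" for e
  \<comment> \<open>The tip lies on the upper edge of the wedge for edges in \<open>A\<close> and below it for edges in \<open>B\<close>.\<close>
  define A where "A = {e \<in> G - top_edges. snd (tip e) = height (nxt e) (fst (tip e))}"
  define B where "B = {e \<in> G - top_edges. snd (tip e) < height (nxt e) (fst (tip e))}"
  have wd: "wedge e (nxt e) (tip e)" if "e \<in> G - top_edges" for e
    using z[OF that] by (simp add: tip_def nxt_def)
  have G: "G = top_edges \<union> A \<union> B"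
  proof -
    have "snd (tip e) \<le> height (nxt e) (fst (tip e))" if "e \<in> G - top_edges" for e
      using wd[OF that] by (simp add: wedge_def)
    then show ?thesis by (force simp: A_def B_def top_edges_def)
  qed
  have "inj_on fst top_edges"
  proof (rule inj_onI)
    fix e f assume "e \<in> top_edges" "f \<in> top_edges" "fst e = fst f"
    then have "e \<in> G" "f \<in> G" "slope e = slope f" by (auto simp: top_edges_def intro: order.antisym)
    then show "e = f" using eq_if_same_slope_at_left \<open>fst e = fst f\<close> by blast
  qed
  moreover have "fst ` top_edges \<subseteq> V" using edge by (auto simp: top_edges_def)
  ultimately have 1: "card top_edges \<le> card V" using card_inj_on_le finite_V by blast
  have tipV: "tip ` A \<subseteq> V" "tip ` B \<subseteq> V"
    using wd by (auto simp: A_def B_def wedge_def)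
  have same: "e = f" if "e \<in> G - top_edges" "f \<in> G - top_edges" "tip e = tip f"
    "(snd (tip e) = height (nxt e) (fst (tip e))) = (snd (tip f) = height (nxt f) (fst (tip f)))" for e f
    using wedges_with_same_tip[of e "nxt e" "tip e" f "nxt f"] wd[OF that(1)] wd[OF that(2)] that
    by (cases "e = f") auto
  have "inj_on tip A" "inj_on tip B"
    by (rule inj_onI, rule same; force simp: A_def B_def)+
  then have 2: "card A \<le> card V" "card B \<le> card V"
    using card_inj_on_le finite_V tipV by blast+
  have "card G \<le> card top_edges + card A + card B"
    by (subst G) (use card_Un_le[of "top_edges \<union> A" B] card_Un_le[of top_edges A] in linarith)
  then show ?thesis using 1 2 by simp
qed

end

section \<open>Sampling and the crossing lemma\<close>

text \<open>
  This is the probability of the outcome \<open>S\<close> when each element of \<open>A\<close> is selected independently with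
  probability \<open>p\<close>.
\<close>

definition sample_weight :: "real \<Rightarrow> 'a set \<Rightarrow> 'a set \<Rightarrow> real" where
  "sample_weight p A S = p ^ card S * (1 - p) ^ card (A - S)"

text \<open>
  Expanding \<open>\<Prod>x\<in>A. (p + g x)\<close>, where \<open>g\<close> vanishes on \<open>T\<close> and is \<open>1 - p\<close> elsewhere, gives one summand for each
  \<open>S \<subseteq> A\<close>, and it is nonzero only if \<open>S\<close> contains \<open>T\<close>.
\<close>

lemma sample_contains_prob:
  assumes "finite A" "T \<subseteq> A"
  shows "(\<Sum>S\<in>Pow A. of_bool (T \<subseteq> S) * sample_weight p A S) = p ^ card T"
proof -
  define g where "g x = (if x \<in> T then 0 else 1 - p)" for x
  have "p ^ card T = (\<Prod>x\<in>A. if x \<in> T then p else 1)"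
    using assms by (simp add: prod.If_cases Int_absorb1)
  also have "\<dots> = (\<Prod>x\<in>A. p + g x)"
    by (intro prod.cong) (auto simp: g_def)
  also have "\<dots> = (\<Sum>S\<in>Pow A. (\<Prod>x\<in>S. p) * (\<Prod>x\<in>A-S. g x))"
    using assms by (intro prod_add)
  also have "\<dots> = (\<Sum>S\<in>Pow A. of_bool (T \<subseteq> S) * sample_weight p A S)"
  proof (intro sum.cong refl)
    fix S assume "S \<in> Pow A"
    show "(\<Prod>x\<in>S. p) * (\<Prod>x\<in>A-S. g x) = of_bool (T \<subseteq> S) * sample_weight p A S"
    proof (cases "T \<subseteq> S")
      case True
      then have "(\<Prod>x\<in>A-S. g x) = (\<Prod>x\<in>A-S. 1 - p)"
        by (intro prod.cong) (auto simp: g_def)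
      then show ?thesis using True by (simp add: sample_weight_def)
    next
      case False
      then have "\<exists>x\<in>A-S. g x = 0" using assms by (auto simp: g_def)
      then have "(\<Prod>x\<in>A-S. g x) = 0" using assms by (intro prod_zero) auto
      then show ?thesis using False by simp
    qed
  qed
  finally show ?thesis by simp
qed

lemma sample_expected_count:
  assumes "finite A" "finite I" and "\<And>i. i \<in> I \<Longrightarrow> T i \<subseteq> A \<and> card (T i) = m"
  shows "(\<Sum>S\<in>Pow A. real (card {i \<in> I. T i \<subseteq> S}) * sample_weight p A S) = real (card I) * p ^ m"
proof -
  have "real (card {i \<in> I. T i \<subseteq> S}) = (\<Sum>i\<in>I. of_bool (T i \<subseteq> S))" for S
    using assms by (simp add: of_bool_def sum.If_cases Int_def)
  then have "(\<Sum>S\<in>Pow A. real (card {i \<in> I. T i \<subseteq> S}) * sample_weight p A S)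
    = (\<Sum>S\<in>Pow A. \<Sum>i\<in>I. of_bool (T i \<subseteq> S) * sample_weight p A S)"
    by (simp add: sum_distrib_right)
  also have "\<dots> = (\<Sum>i\<in>I. p ^ m)"
    by (subst sum.swap) (intro sum.cong refl, use assms sample_contains_prob in fastforce)
  finally show ?thesis by simp
qed

context straight_line_graph
begin

definition crossings :: "(edge \<times> edge) set" where
  "crossings = {(e, f). e \<in> G \<and> f \<in> G \<and> crosses e f}"

lemma finite_crossings: "finite crossings"
  by (rule finite_subset[of _ "G \<times> G"]) (use finite_G in \<open>auto simp: crossings_def\<close>)

text \<open>
  Deleting every crossed edge from the subgraph induced by \<open>S\<close> leaves a crossing-free graph. Each
  deleted edge is the first component of some ordered pair of crossing edges, so there are at
  most as many deletions as such pairs.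
\<close>

lemma induced_edges_le:
  assumes "S \<subseteq> V"
  shows "card {e \<in> G. {fst e, snd e} \<subseteq> S} \<le>
    3 * card S + card {z \<in> crossings. {fst (fst z), snd (fst z), fst (snd z), snd (snd z)} \<subseteq> S}"
proof -
  define GS where "GS = {e \<in> G. {fst e, snd e} \<subseteq> S}"
  define X where "X = {z \<in> crossings. {fst (fst z), snd (fst z), fst (snd z), snd (snd z)} \<subseteq> S}"
  have sub: "GS \<subseteq> G" by (auto simp: GS_def)
  interpret H: plane_straight_line_graph S "GS - fst ` X"
  proof
    show "finite S" using assms finite_V finite_subset by blast
    show "inj_on fst S" using assms inj_fst inj_on_subset by blast
    show "fst e \<in> S \<and> snd e \<in> S \<and> fst (fst e) < fst (snd e)" if "e \<in> GS - fst ` X" for e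
      using that edge by (auto simp: GS_def)
    show "height e (fst v) \<noteq> snd v" if "e \<in> GS - fst ` X" "v \<in> S" "spans e (fst v)" for e v
      using that avoids assms sub by blast
    show "\<not> crosses e f" if "e \<in> GS - fst ` X" "f \<in> GS - fst ` X" for e f
    proof
      assume "crosses e f"
      then have "(e, f) \<in> X" using that by (auto simp: X_def crossings_def GS_def)
      then have "e \<in> fst ` X" by force
      then show False using that by blast
    qed
  qed
  have fin: "finite X" "finite GS"
    using finite_crossings finite_G sub finite_subset by (auto simp: X_def)
  have "card GS \<le> card (GS - fst ` X) + card (fst ` X)"
    using card_Un_le[of "GS - fst ` X" "fst ` X"] fin
      card_mono[of "(GS - fst ` X) \<union> fst ` X" GS] by fastforce
  also have "\<dots> \<le> 3 * card S + card X"
    using H.card_edges_le card_image_le[OF fin(1), of fst] by linarith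
  finally show ?thesis by (simp add: GS_def X_def)
qed

text \<open>
  Taking expectations in \<open>induced_edges_le\<close>: a random sample contains a vertex, an edge and a
  crossing with probability \<open>p\<close>, \<open>p\<^sup>2\<close> and \<open>p\<^sup>4\<close>.
\<close>

lemma expected_induced_edges_le:
  assumes "0 \<le> p" "p \<le> 1"
  shows "real (card G) * p\<^sup>2 \<le> 3 * (real (card V) * p) + real (card crossings) * p ^ 4"
proof -
  let ?w = "sample_weight p V"
  let ?ge = "\<lambda>S. {e \<in> G. {fst e, snd e} \<subseteq> S}"
  let ?gx = "\<lambda>S. {z \<in> crossings. {fst (fst z), snd (fst z), fst (snd z), snd (snd z)} \<subseteq> S}"
  let ?gv = "\<lambda>S. {v \<in> V. {v} \<subseteq> S}"
  have "real (card G) * p ^ 2 = (\<Sum>S\<in>Pow V. real (card (?ge S)) * ?w S)"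
  proof (rule sample_expected_count[symmetric, OF finite_V finite_G])
    fix e assume "e \<in> G"
    then show "{fst e, snd e} \<subseteq> V \<and> card {fst e, snd e} = 2"
      using edge[of e] by (auto simp: card_insert_if)
  qed
  also have "\<dots> \<le> (\<Sum>S\<in>Pow V. 3 * (real (card (?gv S)) * ?w S) + real (card (?gx S)) * ?w S)"
  proof (rule sum_mono)
    fix S assume S: "S \<in> Pow V"
    then have gv: "?gv S = S" by auto
    have "card (?ge S) \<le> 3 * card S + card (?gx S)" using S by (intro induced_edges_le) simp
    then have "real (card (?ge S)) \<le> 3 * real (card (?gv S)) + real (card (?gx S))"
      unfolding gv by linarith
    moreover have "?w S \<ge> 0" using assms by (simp add: sample_weight_def)
    ultimately have "real (card (?ge S)) * ?w S \<le> (3 * real (card (?gv S)) + real (card (?gx S))) * ?w S"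
      by (rule mult_right_mono)
    then show "real (card (?ge S)) * ?w S \<le> 3 * (real (card (?gv S)) * ?w S) + real (card (?gx S)) * ?w S"
      by (simp add: algebra_simps)
  qed
  also have "\<dots> = 3 * (\<Sum>S\<in>Pow V. real (card (?gv S)) * ?w S) + (\<Sum>S\<in>Pow V. real (card (?gx S)) * ?w S)"
    by (simp add: sum.distrib sum_distrib_left)
  also have "(\<Sum>S\<in>Pow V. real (card (?gv S)) * ?w S) = real (card V) * p ^ 1"
    by (rule sample_expected_count[OF finite_V finite_V]) auto
  also have "(\<Sum>S\<in>Pow V. real (card (?gx S)) * ?w S) = real (card crossings) * p ^ 4"
  proof (rule sample_expected_count[OF finite_V finite_crossings])
    fix z assume "z \<in> crossings"
    then have z: "fst z \<in> G" "snd z \<in> G" "crosses (fst z) (snd z)" by (auto simp: crossings_def)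
    then show "{fst (fst z), snd (fst z), fst (snd z), snd (snd z)} \<subseteq> V \<and>
       card {fst (fst z), snd (fst z), fst (snd z), snd (snd z)} = 4"
      using edge crosses_imp_no_common_vertex[OF z] by (simp add: card_insert_if)
  qed
  finally show ?thesis by simp
qed

theorem crossing_lemma:
  assumes "4 * card V \<le> card G"
  shows "card G ^ 3 \<le> 64 * card V ^ 2 * card crossings"
proof (cases "card V = 0")
  case True
  then have "V = {}" using finite_V by simp
  then have "G = {}" using edge by blast
  then show ?thesis by simp
next
  case False
  define v e x where "v = real (card V)" and "e = real (card G)" and "x = real (card crossings)"
  have ev: "4 * v \<le> e" "v > 0" using assms False by (auto simp: v_def e_def)
  \<comment> \<open>With this \<open>p\<close> the term \<open>e p\<^sup>2\<close> exceeds \<open>3 v p\<close> by exactly \<open>v p\<close>, which crossings must make up for;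
    \<open>p\<close> is a probability because the graph has enough edges.\<close>
  define p where "p = 4 * v / e"
  have p: "0 < p" "p \<le> 1" and pe: "e * p = 4 * v" using ev by (auto simp: p_def field_simps)
  have "e * p\<^sup>2 \<le> 3 * (v * p) + x * p ^ 4"
    using expected_induced_edges_le[of p] p by (simp add: v_def e_def x_def)
  also have "e * p\<^sup>2 = 4 * v * p" using pe by (simp add: power2_eq_square flip: pe)
  finally have "v * p \<le> (x * p ^ 3) * p" by (simp add: power_numeral_reduce algebra_simps)
  then have "v \<le> x * p ^ 3" using p by simp
  then have "v * e ^ 3 \<le> x * p ^ 3 * e ^ 3" using ev by (intro mult_right_mono) auto
  also have "\<dots> = x * (e * p) ^ 3" by (simp add: power_mult_distrib)
  also have "\<dots> = v * (64 * v\<^sup>2 * x)" by (simp add: pe power_mult_distrib power_numeral_reduce)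
  finally have "e ^ 3 \<le> 64 * v\<^sup>2 * x" using ev by simp
  then have "real (card G ^ 3) \<le> real (64 * card V ^ 2 * card crossings)"
    by (simp add: v_def e_def x_def)
  then show ?thesis by linarith
qed

end

section \<open>The Szemeredi-Trotter theorem\<close>

text \<open>
  The pair \<open>(a, b)\<close> stands for the line \<open>y = a x + b\<close>. Vertical lines are excluded; a shear of the plane
  will bring any finite configuration into this position.
\<close>

definition on_line :: "point \<Rightarrow> real \<times> real \<Rightarrow> bool" where
  "on_line p l \<longleftrightarrow> snd p = fst l * fst p + snd l"

lemma height_on_line:
  assumes "on_line (fst e) l" "on_line (snd e) l" "fst (fst e) < fst (snd e)"
  shows "height e x = fst l * x + snd l"
proof -
  have "slope e = (fst l * (fst (snd e) - fst (fst e))) / (fst (snd e) - fst (fst e))"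
    using assms by (simp add: slope_def on_line_def algebra_simps)
  then have "slope e = fst l" using assms by simp
  then show ?thesis using assms by (simp add: height_def on_line_def algebra_simps)
qed

lemma line_through_two_points_unique:
  assumes "on_line p l" "on_line q l" "on_line p m" "on_line q m" "fst p \<noteq> fst q"
  shows "l = m"
proof -
  have "fst l * (fst p - fst q) = fst m * (fst p - fst q)"
    using assms by (simp add: on_line_def algebra_simps)
  then have "fst l = fst m" using assms by simp
  then show ?thesis using assms by (auto simp: on_line_def prod_eq_iff)
qed

definition consecutive :: "point set \<Rightarrow> real \<times> real \<Rightarrow> edge \<Rightarrow> bool" where
  "consecutive P l e \<longleftrightarrow> fst e \<in> P \<and> snd e \<in> P \<and> fst (fst e) < fst (snd e)
     \<and> on_line (fst e) l \<and> on_line (snd e) l \<and> (\<forall>r\<in>P. on_line r l \<longrightarrow> \<not> spans e (fst r))"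

lemma consecutive_overlap_eq:
  assumes "inj_on fst P" "consecutive P l e" "consecutive P l f" "spans e x" "spans f x"
  shows "e = f"
proof -
  have "fst (fst e) = fst (fst f)" "fst (snd e) = fst (snd f)"
    using assms unfolding consecutive_def spans_def by (smt (verit))+
  then show ?thesis using assms unfolding consecutive_def
    by (metis inj_onD prod_eq_iff)
qed

lemma powr_two_thirds_cubed:
  fixes x :: real
  assumes "0 \<le> x"
  shows "(x powr (2/3)) ^ 3 = x\<^sup>2"
proof (cases "x = 0")
  case False
  have "(x powr (2/3)) ^ 3 = x powr (of_nat 3 * (2/3))" using False by (intro powr_power) simp
  also have "\<dots> = x powr 2" by simp
  also have "\<dots> = x\<^sup>2" using assms False by simp
  finally show ?thesis .
qed simp

locale points_and_lines =
  fixes P :: "point set" and L :: "(real \<times> real) set"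
  assumes finite_P: "finite P" and finite_L: "finite L" and inj_fst_P: "inj_on fst P"
begin

definition incidences :: "(point \<times> (real \<times> real)) set" where
  "incidences = {(p, l). p \<in> P \<and> l \<in> L \<and> on_line p l}"

definition segments :: "edge set" where
  "segments = {e. \<exists>l\<in>L. consecutive P l e}"

text \<open>
  A vertex inside a segment would lie on the line of that segment, between two consecutive points
  of that line.
\<close>

sublocale straight_line_graph P segments
proof
  fix e v assume "e \<in> segments" "v \<in> P" "spans e (fst v)"
  then obtain l where l: "l \<in> L" "consecutive P l e" by (auto simp: segments_def)
  then have "height e (fst v) = fst l * fst v + snd l"
    by (intro height_on_line) (auto simp: consecutive_def)
  moreover have "\<not> on_line v l"
    using l \<open>v \<in> P\<close> \<open>spans e (fst v)\<close> by (auto simp: consecutive_def)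
  ultimately show "height e (fst v) \<noteq> snd v" by (auto simp: on_line_def)
qed (use finite_P inj_fst_P in \<open>auto simp: segments_def consecutive_def\<close>)

text \<open>
  Two crossing segments belong to different lines, and these lines determine the crossing: their
  only common point lies inside just one segment of each line.
\<close>

lemma card_crossings_le: "card crossings \<le> card L ^ 2"
proof -
  have "\<forall>e\<in>segments. \<exists>l\<in>L. consecutive P l e" by (auto simp: segments_def)
  then obtain ln where ln: "\<And>e. e \<in> segments \<Longrightarrow> ln e \<in> L" "\<And>e. e \<in> segments \<Longrightarrow> consecutive P (ln e) e"
    by metis
  have ht: "height e x = fst (ln e) * x + snd (ln e)" if "e \<in> segments" for e x
    using ln(2)[OF that] by (intro height_on_line) (auto simp: consecutive_def)
  have eqI: "e = f" if "e \<in> segments" "f \<in> segments" "ln e = ln f" "spans e x" "spans f x" for e f x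
    using consecutive_overlap_eq[OF inj_fst_P, of "ln e" e f x] ln(2) that by metis
  have "inj_on (\<lambda>z. (ln (fst z), ln (snd z))) crossings"
  proof (rule inj_onI)
    fix y z assume yz: "y \<in> crossings" "z \<in> crossings"
      and "(ln (fst y), ln (snd y)) = (ln (fst z), ln (snd z))"
    then have eq: "ln (fst y) = ln (fst z)" "ln (snd y) = ln (snd z)" by auto
    have yzG: "fst y \<in> segments" "snd y \<in> segments" "fst z \<in> segments" "snd z \<in> segments"
      and "crosses (fst y) (snd y)" "crosses (fst z) (snd z)" using yz by (auto simp: crossings_def)
    then obtain s t where s: "fst y \<noteq> snd y" "spans (fst y) s" "spans (snd y) s" "height (fst y) s = height (snd y) s"
      and t: "spans (fst z) t" "spans (snd z) t" "height (fst z) t = height (snd z) t"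
      unfolding crosses_def by blast
    define a b where "a = ln (fst y)" and "b = ln (snd y)"
    have ab: "a \<noteq> b" using eqI[of "fst y" "snd y" s] s yzG by (auto simp: a_def b_def)
    have "fst a * s + snd a = fst b * s + snd b" "fst a * t + snd a = fst b * t + snd b"
      using s t ht yzG eq by (auto simp: a_def b_def)
    then have "s = t" using ab line_through_two_points_unique[of "(s, fst a * s + snd a)" a "(t, fst a * t + snd a)" b]
      by (auto simp: on_line_def)
    then have "fst y = fst z" "snd y = snd z"
      using eqI[of "fst y" "fst z" s] eqI[of "snd y" "snd z" s] s t yzG eq by auto
    then show "y = z" by (simp add: prod_eq_iff)
  qed
  moreover have "(\<lambda>z. (ln (fst z), ln (snd z))) ` crossings \<subseteq> L \<times> L"
    using ln by (auto simp: crossings_def)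
  ultimately have "card crossings \<le> card (L \<times> L)"
    using finite_L by (intro card_inj_on_le) auto
  then show ?thesis by (simp add: card_cartesian_product power2_eq_square)
qed

text \<open>
  An incidence is sent to the segment that leads from its point to the next point on its line.
  This fails only for the rightmost point of each line.
\<close>

lemma card_incidences_le: "card incidences \<le> card L + card segments"
proof -
  define ends where "ends = {(p, l) \<in> incidences. \<forall>r\<in>P. on_line r l \<longrightarrow> fst r \<le> fst p}"
  have finI: "finite incidences"
    by (rule finite_subset[of _ "P \<times> L"]) (use finite_P finite_L in \<open>auto simp: incidences_def\<close>)
  have "inj_on snd ends"
  proof (rule inj_onI)
    fix y z assume "y \<in> ends" "z \<in> ends" "snd y = snd z"
    then have yz: "fst y \<in> P" "fst z \<in> P" "on_line (fst y) (snd y)" "on_line (fst z) (snd y)"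
      and "\<And>r. r \<in> P \<Longrightarrow> on_line r (snd y) \<Longrightarrow> fst r \<le> fst (fst y)"
      and "\<And>r. r \<in> P \<Longrightarrow> on_line r (snd y) \<Longrightarrow> fst r \<le> fst (fst z)"
      by (auto simp: ends_def incidences_def)
    then have "fst (fst y) = fst (fst z)" by (meson order.antisym)
    then show "y = z" using inj_fst_P \<open>snd y = snd z\<close> yz by (metis inj_onD prod_eq_iff)
  qed
  moreover have "snd ` ends \<subseteq> L" by (auto simp: ends_def incidences_def)
  ultimately have 1: "card ends \<le> card L" using card_inj_on_le finite_L by blast
  have "\<exists>q. consecutive P (snd z) (fst z, q)" if "z \<in> incidences - ends" for z
  proof -
    define Q where "Q = {q \<in> P. on_line q (snd z) \<and> fst (fst z) < fst q}"
    have "finite Q" using finite_P by (simp add: Q_def)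
    have "\<exists>q. q \<in> Q"
      using that by (force simp: Q_def ends_def incidences_def not_le)
    then have "Q \<noteq> {}" by blast
    define q where "q = arg_min_on fst Q"
    have q: "q \<in> Q" unfolding q_def by (intro arg_min_if_finite(1)) fact+
    have least: "fst q \<le> fst r" if "r \<in> Q" for r
      unfolding q_def by (intro arg_min_least) fact+
    have "consecutive P (snd z) (fst z, q)"
      unfolding consecutive_def
    proof (intro conjI ballI impI)
      fix r assume r: "r \<in> P" "on_line r (snd z)"
      show "\<not> spans (fst z, q) (fst r)"
        using least[of r] r by (auto simp: Q_def spans_def)
    qed (use q that in \<open>auto simp: Q_def incidences_def\<close>)
    then show ?thesis by blast
  qed
  then obtain nx where nx: "\<And>z. z \<in> incidences - ends \<Longrightarrow> consecutive P (snd z) (fst z, nx z)"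
    by metis
  have "inj_on (\<lambda>z. (fst z, nx z)) (incidences - ends)"
  proof (rule inj_onI)
    fix y z assume y: "y \<in> incidences - ends" and z: "z \<in> incidences - ends"
      and "(fst y, nx y) = (fst z, nx z)"
    then have eq: "fst y = fst z" "nx y = nx z" by auto
    have "snd y = snd z"
      using nx[OF y] nx[OF z] eq by (intro line_through_two_points_unique[of "fst y" _ "nx y"])
        (auto simp: consecutive_def)
    then show "y = z" using eq by (simp add: prod_eq_iff)
  qed
  moreover have "(\<lambda>z. (fst z, nx z)) ` (incidences - ends) \<subseteq> segments"
  proof
    fix e assume "e \<in> (\<lambda>z. (fst z, nx z)) ` (incidences - ends)"
    then obtain z where z: "z \<in> incidences - ends" "e = (fst z, nx z)" by blast
    have "snd z \<in> L" using z by (auto simp: incidences_def)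
    then show "e \<in> segments" using nx[OF z(1)] z by (auto simp: segments_def)
  qed
  ultimately have 2: "card (incidences - ends) \<le> card segments" using card_inj_on_le finite_G by blast
  have "ends \<subseteq> incidences" by (auto simp: ends_def)
  then have "card incidences = card ends + card (incidences - ends)"
    using finI by (metis card_Diff_subset card_mono finite_subset le_add_diff_inverse)
  then show ?thesis using 1 2 by linarith
qed

theorem Szemeredi_Trotter:
  "real (card incidences) \<le>
     4 * (real (card P) * real (card L)) powr (2/3) + 4 * real (card P) + real (card L)"
proof -
  let ?m = "real (card P) * real (card L)"
  have "real (card segments) \<le> 4 * ?m powr (2/3) + 4 * real (card P)"
  proof (cases "4 * card P \<le> card segments")
    case True
    have "card segments ^ 3 \<le> 64 * card P ^ 2 * card L ^ 2"
      using crossing_lemma[OF True] card_crossings_le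
      by (meson le_trans mult_le_mono2)
    then have "real (card segments ^ 3) \<le> real (64 * card P ^ 2 * card L ^ 2)" by linarith
    also have "\<dots> = 64 * ?m ^ 2" by (simp add: power_mult_distrib)
    also have "?m ^ 2 = (?m powr (2/3)) ^ 3" by (rule powr_two_thirds_cubed[symmetric]) simp
    also have "64 * (?m powr (2/3)) ^ 3 = (4 * ?m powr (2/3)) ^ 3" by (simp add: power_mult_distrib)
    finally have "real (card segments) ^ 3 \<le> (4 * ?m powr (2/3)) ^ 3" by simp
    then have "real (card segments) \<le> 4 * ?m powr (2/3)"
      using power_mono_iff[of "real (card segments)" "4 * ?m powr (2/3)" 3] by simp
    then show ?thesis by simp
  next
    case False
    then have "real (card segments) \<le> 4 * real (card P)" by linarith
    then show ?thesis by (simp add: add_increasing)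
  qed
  moreover have "real (card incidences) \<le> real (card L) + real (card segments)"
    using card_incidences_le by linarith
  ultimately show ?thesis by linarith
qed

end

section \<open>Pairs with a given dot product\<close>

text \<open>
  For fixed \<open>q \<noteq> 0\<close> the points \<open>p\<close> with \<open>p \<bullet> q = \<alpha>\<close> form a line, and \<open>\<alpha> \<noteq> 0\<close> makes different \<open>q\<close> give different
  lines. A generic horizontal shear separates the abscissas of the points and makes
  all these lines non-vertical.
\<close>

lemma card_dot_pairs_le:
  fixes P Q :: "(real ^ 2) set" and \<alpha> :: real
  assumes fin: "finite P" "finite Q" and "\<alpha> \<noteq> 0"
  shows "real (card {(p, q). p \<in> P \<and> q \<in> Q \<and> p \<bullet> q = \<alpha>})
    \<le> 4 * (real (card P) * real (card Q)) powr (2/3) + 4 * real (card P) + real (card Q)"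
proof -
  \<comment> \<open>The first kind of bad shear gives two points of \<open>P\<close> the same abscissa, the second kind makes
    the line of some \<open>q\<close> vertical.\<close>
  define bad where "bad = (\<lambda>(p, q). (p $ 1 - q $ 1) / (q $ 2 - p $ 2)) ` (P \<times> P) \<union> (\<lambda>q. q $ 2 / q $ 1) ` Q"
  have "finite bad" using fin by (simp add: bad_def)
  then obtain s where s: "s \<notin> bad" using ex_new_if_finite infinite_UNIV_char_0 by blast
  define sh where "sh p = (p $ 1 + s * p $ 2, p $ 2)" for p :: "real ^ 2"
  define d where "d q = q $ 2 - s * q $ 1" for q :: "real ^ 2"
  \<comment> \<open>In the sheared coordinates \<open>x' = p $ 1 + s * p $ 2\<close>, \<open>y' = p $ 2\<close> the equation \<open>p \<bullet> q = \<alpha>\<close> reads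
    \<open>q $ 1 * x' + d q * y' = \<alpha>\<close>.\<close>
  define ln where "ln q = (- q $ 1 / d q, \<alpha> / d q)" for q :: "real ^ 2"
  have dot: "p \<bullet> q = p $ 1 * q $ 1 + p $ 2 * q $ 2" for p q :: "real ^ 2"
    by (simp add: inner_vec_def sum_2)
  have fst_sh: "inj_on (\<lambda>p. fst (sh p)) P"
  proof (rule inj_onI)
    fix p q assume pq: "p \<in> P" "q \<in> P" "fst (sh p) = fst (sh q)"
    then have eq: "s * (q $ 2 - p $ 2) = p $ 1 - q $ 1" by (simp add: sh_def algebra_simps)
    have "p $ 2 = q $ 2"
    proof (rule ccontr)
      assume "p $ 2 \<noteq> q $ 2"
      then have "s = (p $ 1 - q $ 1) / (q $ 2 - p $ 2)" using eq by (simp add: eq_divide_eq)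
      then have "s \<in> bad" using pq unfolding bad_def by force
      then show False using s by blast
    qed
    then show "p = q" using eq by (simp add: vec_eq_iff forall_2)
  qed
  have inj_sh: "inj_on sh P" using fst_sh by (auto simp: inj_on_def)
  have d: "d q \<noteq> 0" if "q \<in> Q - {0}" for q
  proof
    assume 0: "d q = 0"
    have "q $ 1 \<noteq> 0"
      using 0 that by (auto simp: d_def vec_eq_iff forall_2)
    then have "s = q $ 2 / q $ 1" using 0 by (simp add: d_def field_simps)
    then show False using s that by (auto simp: bad_def)
  qed
  have inj_ln: "inj_on ln (Q - {0})"
  proof (rule inj_onI)
    fix q r assume qr: "q \<in> Q - {0}" "r \<in> Q - {0}" "ln q = ln r"
    then have "d q = d r" using d[of q] d[of r] \<open>\<alpha> \<noteq> 0\<close> by (auto simp: ln_def field_simps)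
    then have "q $ 1 = r $ 1" using qr d[of q] by (auto simp: ln_def)
    then show "q = r" using \<open>d q = d r\<close> by (simp add: d_def vec_eq_iff forall_2)
  qed
  interpret S: points_and_lines "sh ` P" "ln ` (Q - {0})"
    using fin fst_sh by unfold_locales (auto simp: inj_on_def)
  let ?I = "{(p, q). p \<in> P \<and> q \<in> Q \<and> p \<bullet> q = \<alpha>}"
  have I: "p \<in> P" "q \<in> Q - {0}" "on_line (sh p) (ln q)" if "(p, q) \<in> ?I" for p q
  proof -
    show "p \<in> P" "q \<in> Q - {0}" using that \<open>\<alpha> \<noteq> 0\<close> by auto
    have "p $ 2 * d q = - q $ 1 * (p $ 1 + s * p $ 2) + \<alpha>"
      using that by (simp add: dot d_def algebra_simps)
    then have "p $ 2 = (- q $ 1 * (p $ 1 + s * p $ 2) + \<alpha>) / d q"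
      using d[OF \<open>q \<in> Q - {0}\<close>] by (simp add: eq_divide_eq)
    then show "on_line (sh p) (ln q)"
      by (simp add: on_line_def sh_def ln_def add_divide_distrib diff_divide_distrib)
  qed
  have "card ?I \<le> card S.incidences"
  proof (rule card_inj_on_le)
    show "inj_on (map_prod sh ln) ?I"
      by (rule inj_on_subset[OF map_prod_inj_on[OF inj_sh inj_ln]]) (use I in auto)
    show "map_prod sh ln ` ?I \<subseteq> S.incidences"
      using I by (force simp: S.incidences_def)
    show "finite S.incidences"
      by (rule finite_subset[of _ "sh ` P \<times> ln ` (Q - {0})"]) (use fin in \<open>auto simp: S.incidences_def\<close>)
  qed
  then have "real (card ?I) \<le> real (card S.incidences)" by simp
  also have "\<dots> \<le> 4 * (real (card (sh ` P)) * real (card (ln ` (Q - {0})))) powr (2/3)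
      + 4 * real (card (sh ` P)) + real (card (ln ` (Q - {0})))"
    by (rule S.Szemeredi_Trotter)
  also have "\<dots> \<le> 4 * (real (card P) * real (card Q)) powr (2/3) + 4 * real (card P) + real (card Q)"
  proof -
    have 1: "card (sh ` P) = card P" using inj_sh by (rule card_image)
    have 2: "card (ln ` (Q - {0})) \<le> card Q"
      using fin card_image_le[of "Q - {0}" ln] card_mono[of Q "Q - {0}"] by fastforce
    have "(real (card P) * real (card (ln ` (Q - {0})))) powr (2/3) \<le> (real (card P) * real (card Q)) powr (2/3)"
      using 2 by (intro powr_mono2 mult_left_mono) auto
    then show ?thesis using 2 unfolding 1 by linarith
  qed
  finally show ?thesis .
qed

corollary card_dot_pairs_le_n43:
  fixes E :: "(real ^ 2) set"
  assumes "finite E" "\<alpha> \<noteq> 0"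
  shows "real (card {(p, q). p \<in> E \<and> q \<in> E \<and> p \<bullet> q = \<alpha>}) \<le> 9 * real (card E) powr (4/3)"
proof (cases "card E = 0")
  case True
  then have "E = {}" using assms by simp
  then show ?thesis by simp
next
  case False
  define n where "n = real (card E)"
  have n: "n \<ge> 1" using False by (simp add: n_def)
  have "(n * n) powr (2/3) = n powr (4/3)"
    using n by (simp add: powr_mult flip: powr_add)
  moreover have "n powr 1 \<le> n powr (4/3)" using n by (intro powr_mono) auto
  ultimately show ?thesis
    using card_dot_pairs_le[OF assms(1) assms(1) assms(2)] n by (simp flip: n_def)
qed

text \<open>
  The solutions \<open>p\<close> of \<open>p \<bullet> r = x\<close> form a line unless \<open>r = 0\<close>, when there are none.
\<close>

lemma card_on_dot_line_le:
  fixes E :: "(real ^ 2) set"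
  assumes "finite E" "\<And>L. is_line L \<Longrightarrow> card (E \<inter> L) \<le> t" "x \<noteq> 0"
  shows "card {p \<in> E. p \<bullet> r = x} \<le> t"
proof (cases "r = 0")
  case False
  have "is_line {p. r \<bullet> p = x}"
    unfolding is_line_def using False by (simp add: affine_hyperplane)
  moreover have "{p \<in> E. p \<bullet> r = x} = E \<inter> {p. r \<bullet> p = x}" by (auto simp: inner_commute)
  ultimately show ?thesis using assms by simp
qed (use assms in simp)

section \<open>Chains\<close>

lemma Cons_in_dot_chains_iff:
  "r # R \<in> dot_chains (x # \<alpha>) E \<longleftrightarrow> r \<in> E \<and> R \<in> dot_chains \<alpha> E \<and> r \<bullet> hd R = x"
proof (cases R)
  case (Cons s S)
  then show ?thesis by (auto simp: dot_chains_def All_less_Suc2)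
qed (simp add: dot_chains_def)

lemma dot_chains_Cons:
  "dot_chains (x # \<alpha>) E = (\<Union>R\<in>dot_chains \<alpha> E. (\<lambda>r. r # R) ` {r \<in> E. r \<bullet> hd R = x})"
proof -
  have "R \<in> dot_chains (x # \<alpha>) E \<longleftrightarrow>
      (\<exists>S\<in>dot_chains \<alpha> E. R \<in> (\<lambda>r. r # S) ` {r \<in> E. r \<bullet> hd S = x})" for R
  proof (cases R)
    case Nil
    then show ?thesis by (auto simp: dot_chains_def[of "x # \<alpha>"])
  next
    case (Cons r S)
    then show ?thesis unfolding Cons Cons_in_dot_chains_iff by blast
  qed
  then show ?thesis by (intro set_eqI) (simp only: UN_iff)
qed

lemma finite_dot_chains: "finite E \<Longrightarrow> finite (dot_chains \<alpha> E)"
  by (rule finite_subset[OF _ finite_lists_length_eq[of E "length \<alpha> + 1"]])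
    (auto simp: dot_chains_def)

lemma card_dot_chains_Cons_le:
  assumes "finite E" "\<And>r. card {p \<in> E. p \<bullet> r = x} \<le> t"
  shows "card (dot_chains (x # \<alpha>) E) \<le> t * card (dot_chains \<alpha> E)"
proof -
  have "card (dot_chains (x # \<alpha>) E)
      \<le> (\<Sum>R\<in>dot_chains \<alpha> E. card ((\<lambda>r. r # R) ` {r \<in> E. r \<bullet> hd R = x}))"
    unfolding dot_chains_Cons using assms finite_dot_chains by (intro card_UN_le) auto
  also have "\<dots> \<le> (\<Sum>R\<in>dot_chains \<alpha> E. t)"
    using assms by (intro sum_mono order_trans[OF card_image_le]) auto
  finally show ?thesis by (simp add: mult.commute)
qed

text \<open>
  The condition that links the second point to the third one is dropped.
\<close>

lemma card_dot_chains_Cons_Cons_le: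
  assumes "finite E"
  shows "card (dot_chains (y # x # \<alpha>) E)
    \<le> card {(p, q). p \<in> E \<and> q \<in> E \<and> p \<bullet> q = y} * card (dot_chains \<alpha> E)"
proof -
  let ?I = "{(p, q). p \<in> E \<and> q \<in> E \<and> p \<bullet> q = y}"
  have "finite ?I" by (rule finite_subset[of _ "E \<times> E"]) (use assms in auto)
  have "dot_chains (y # x # \<alpha>) E \<subseteq> (\<lambda>((p, q), R). p # q # R) ` (?I \<times> dot_chains \<alpha> E)"
    unfolding dot_chains_Cons by force
  then have "card (dot_chains (y # x # \<alpha>) E) \<le> card (?I \<times> dot_chains \<alpha> E)"
    using \<open>finite ?I\<close> finite_dot_chains[OF assms] by (intro surj_card_le) auto
  then show ?thesis by (simp add: card_cartesian_product)
qed

lemma card_dot_chains_singleton_le: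
  assumes "finite E"
  shows "card (dot_chains [x] E) \<le> card {(p, q). p \<in> E \<and> q \<in> E \<and> p \<bullet> q = x}"
proof -
  let ?I = "{(p, q). p \<in> E \<and> q \<in> E \<and> p \<bullet> q = x}"
  have "finite ?I" by (rule finite_subset[of _ "E \<times> E"]) (use assms in auto)
  have "dot_chains [x] E \<subseteq> (\<lambda>(p, q). [p, q]) ` ?I"
  proof
    fix R assume "R \<in> dot_chains [x] E"
    then obtain p q where "R = [p, q]" "p \<in> E" "q \<in> E" "p \<bullet> q = x"
      by (auto simp: dot_chains_def length_Suc_conv)
    then show "R \<in> (\<lambda>(p, q). [p, q]) ` ?I" by (intro image_eqI[of _ _ "(p, q)"]) auto
  qed
  then show ?thesis using \<open>finite ?I\<close> by (intro surj_card_le) auto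
qed

text \<open>
  A chain of odd type has an even number of points, which are grouped into \<open>a + 1\<close> pairs.
\<close>

lemma card_dot_chains_odd_le:
  fixes B :: real
  assumes "finite E"
    and "\<And>x. x \<in> set \<alpha> \<Longrightarrow> real (card {(p, q). p \<in> E \<and> q \<in> E \<and> p \<bullet> q = x}) \<le> B"
    and "length \<alpha> = 2 * a + 1"
  shows "real (card (dot_chains \<alpha> E)) \<le> B ^ (a + 1)"
  using assms(2,3)
proof (induction a arbitrary: \<alpha>)
  case 0
  then obtain x where "\<alpha> = [x]" by (auto simp: length_Suc_conv)
  then show ?case using 0 card_dot_chains_singleton_le[OF assms(1), of x] by force
next
  case (Suc a)
  then obtain y x \<beta> where \<alpha>: "\<alpha> = y # x # \<beta>" by (auto simp: length_Suc_conv)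
  let ?I = "{(p, q). p \<in> E \<and> q \<in> E \<and> p \<bullet> q = y}"
  have IH: "real (card (dot_chains \<beta> E)) \<le> B ^ (a + 1)" using Suc \<alpha> by auto
  have y: "real (card ?I) \<le> B" using Suc.prems(1)[of y] \<alpha> by simp
  have "real (card (dot_chains \<alpha> E)) \<le> real (card ?I * card (dot_chains \<beta> E))"
    unfolding \<alpha> of_nat_le_iff by (rule card_dot_chains_Cons_Cons_le[OF assms(1)])
  also have "\<dots> \<le> B * B ^ (a + 1)"
    unfolding of_nat_mult using y IH by (intro mult_mono) (auto intro: order_trans[OF _ y])
  finally show ?case by simp
qed

lemma card_dot_chains_le:
  fixes B :: real
  assumes "finite E"
    and "\<And>x. x \<in> set \<alpha> \<Longrightarrow> real (card {(p, q). p \<in> E \<and> q \<in> E \<and> p \<bullet> q = x}) \<le> B"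
    and "\<And>x r. x \<in> set \<alpha> \<Longrightarrow> card {p \<in> E. p \<bullet> r = x} \<le> t"
    and "length \<alpha> = b + (2 * a + 1)"
  shows "real (card (dot_chains \<alpha> E)) \<le> real t ^ b * B ^ (a + 1)"
  using assms(2-)
proof (induction b arbitrary: \<alpha>)
  case 0
  then show ?case using card_dot_chains_odd_le[OF assms(1)] by simp
next
  case (Suc b)
  then obtain x \<beta> where \<alpha>: "\<alpha> = x # \<beta>" by (auto simp: length_Suc_conv)
  have IH: "real (card (dot_chains \<beta> E)) \<le> real t ^ b * B ^ (a + 1)" using Suc \<alpha> by auto
  have "card (dot_chains \<alpha> E) \<le> t * card (dot_chains \<beta> E)"
    unfolding \<alpha> using Suc.prems(2)[of x] \<alpha> by (intro card_dot_chains_Cons_le[OF assms(1)]) auto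
  then have "real (card (dot_chains \<alpha> E)) \<le> real t * real (card (dot_chains \<beta> E))"
    by (simp flip: of_nat_mult)
  also have "\<dots> \<le> real t * (real t ^ b * B ^ (a + 1))" using IH by (intro mult_left_mono) auto
  finally show ?case by (simp add: mult.assoc)
qed

text \<open>
  The three cases of the bound agree once \<open>k\<close> is split as \<open>b + (2 m + 1)\<close>: the residues 0, 1, 2 of \<open>k\<close>
  correspond to \<open>b = m - 1\<close>, \<open>b = m\<close>, \<open>b = m + 1\<close>.
\<close>

lemma chain_bound_eq:
  assumes m: "m = k div 3" and b: "k = b + (2 * m + 1)"
  shows "chain_bound k t n = log 2 (real n) powr (2 * real b) * real t powr real b
    * real n powr (4/3 * (real m + 1))"
proof -
  have km: "k = 3 * m + k mod 3" using m by simp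
  consider "k mod 3 = 0" | "k mod 3 = 1" | "k mod 3 = 2" by linarith
  then show ?thesis
  proof cases
    case 1
    then have "real k = 3 * real m" "real b = real m - 1" using km b by linarith+
    then have ex: "(2 * real k - 6) / 3 = 2 * real b" "(real k - 3) / 3 = real b"
       "(4 * real k + 12) / 9 = 4/3 * (real m + 1)" by (auto simp: field_simps)
    have "chain_bound k t n = log 2 (real n) powr ((2 * real k - 6) / 3)
        * real t powr ((real k - 3) / 3) * real n powr ((4 * real k + 12) / 9)"
      using 1 by (simp add: chain_bound_def)
    then show ?thesis by (simp only: ex)
  next
    case 2
    then have "real k = 3 * real m + 1" "real b = real m" using km b by linarith+
    then have ex: "(2 * real k - 2) / 3 = 2 * real b" "(real k - 1) / 3 = real b"
       "(4 * real k + 8) / 9 = 4/3 * (real m + 1)" by (auto simp: field_simps)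
    have "chain_bound k t n = log 2 (real n) powr ((2 * real k - 2) / 3)
        * real t powr ((real k - 1) / 3) * real n powr ((4 * real k + 8) / 9)"
      using 2 by (simp add: chain_bound_def)
    then show ?thesis by (simp only: ex)
  next
    case 3
    then have "real k = 3 * real m + 2" "real b = real m + 1" using km b by linarith+
    then have ex: "(2 * real k + 2) / 3 = 2 * real b" "(real k + 1) / 3 = real b"
       "(4 * real k + 4) / 9 = 4/3 * (real m + 1)" by (auto simp: field_simps)
    have "chain_bound k t n = log 2 (real n) powr ((2 * real k + 2) / 3)
        * real t powr ((real k + 1) / 3) * real n powr ((4 * real k + 4) / 9)"
      using 3 by (simp add: chain_bound_def)
    then show ?thesis by (simp only: ex)
  qed
qed

theorem corollary1p6:
  fixes k :: nat
  assumes "k \<ge> 1"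
  shows "\<exists>C::real. \<exists>N::nat. C > 0 \<and>
           (\<forall>n t :: nat. \<forall>E :: (real ^ 2) set. \<forall>\<alpha> :: real list.
              n > N \<longrightarrow> t \<ge> 1 \<longrightarrow>
              finite E \<longrightarrow> card E = n \<longrightarrow>
              (\<forall>L. is_line L \<longrightarrow> card (E \<inter> L) \<le> t) \<longrightarrow>
              length \<alpha> = k \<longrightarrow> (\<forall>a \<in> set \<alpha>. a \<noteq> 0) \<longrightarrow>
              real (card (dot_chains \<alpha> E)) \<le> C * chain_bound k t n)"
proof -
  define m where "m = k div 3"
  define b where "b = k - (2 * m + 1)"
  have k: "k = b + (2 * m + 1)" using assms by (auto simp: b_def m_def)
  have "real (card (dot_chains \<alpha> E)) \<le> 9 ^ (m + 1) * chain_bound k t n"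
    if n: "n > 1" and t: "t \<ge> 1" and E: "finite E" "card E = n"
      and lines: "\<forall>L. is_line L \<longrightarrow> card (E \<inter> L) \<le> t"
      and \<alpha>: "length \<alpha> = k" "\<forall>a \<in> set \<alpha>. a \<noteq> 0"
    for n t :: nat and E :: "(real ^ 2) set" and \<alpha> :: "real list"
  proof -
    have "real (card (dot_chains \<alpha> E)) \<le> real t ^ b * (9 * real n powr (4/3)) ^ (m + 1)"
    proof (rule card_dot_chains_le[OF E(1)])
      fix x assume "x \<in> set \<alpha>"
      then have "x \<noteq> 0" using \<alpha> by blast
      show "real (card {(p, q). p \<in> E \<and> q \<in> E \<and> p \<bullet> q = x}) \<le> 9 * real n powr (4/3)"
        using card_dot_pairs_le_n43[OF E(1) \<open>x \<noteq> 0\<close>] E(2) by simp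
      show "card {p \<in> E. p \<bullet> r = x} \<le> t" for r
        using card_on_dot_line_le[OF E(1) _ \<open>x \<noteq> 0\<close>] lines by blast
    qed (use k \<alpha> in simp)
    also have "\<dots> = 9 ^ (m + 1) * (real t powr real b * real n powr (4/3 * (real m + 1)))"
    proof -
      have "(real n powr (4/3)) ^ (m + 1) = real n powr (of_nat (m + 1) * (4/3))"
        using n by (intro powr_power) simp
      also have "of_nat (m + 1) * (4/3) = 4/3 * (real m + 1)" by simp
      finally have "(real n powr (4/3)) ^ (m + 1) = real n powr (4/3 * (real m + 1))" .
      moreover have "real t powr real b = real t ^ b" using t by (intro powr_realpow) simp
      ultimately show ?thesis by (simp only: power_mult_distrib mult_ac)
    qed
    also have "\<dots> \<le> 9 ^ (m + 1) * (log 2 (real n) powr (2 * real b) *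
        (real t powr real b * real n powr (4/3 * (real m + 1))))"
    proof -
      have "1 \<le> log 2 (real n)" using n by simp
      then have "1 \<le> log 2 (real n) powr (2 * real b)" by (intro ge_one_powr_ge_zero) auto
      then have "1 * (real t powr real b * real n powr (4/3 * (real m + 1)))
        \<le> log 2 (real n) powr (2 * real b) * (real t powr real b * real n powr (4/3 * (real m + 1)))"
        by (intro mult_right_mono) auto
      then show ?thesis by (intro mult_left_mono) auto
    qed
    also have "\<dots> = 9 ^ (m + 1) * chain_bound k t n"
      by (simp only: chain_bound_eq[OF m_def k] mult.assoc)
    finally show ?thesis .
  qed
  then show ?thesis by (intro exI[of _ "9 ^ (m + 1)"] exI[of _ 1]) auto
qed

end
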